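(* Let $I\subset\mathbb R$ be an interval, let $G:I\to J\subset\mathbb R$ be in $C^\infty(I)$ with $|G'(x)|>0$ for all $x\in I$, and let $H\in C^\infty(I)$. Let $C>0$ and $M\in\mathbb N$. Further, for some fixed $x_0\in I$ and $0<|\tau|\le\pi/C$ let $\tau k+G(x_0)\in G(I)$ for $k=0,\dots,2M-1$, where $G(I):=\{G(x):x\in I\}$ denotes the image of $G$. Then each function $$f(x)=\sum_{j=1}^M c_j\,\mathrm e^{H(x)+\lambda_jG(x)},\qquad x\in I,$$ with $c_j\in\mathbb C\setminus\{0\}$ and pairwise distinct $\lambda_j\in\mathbb R+\mathrm i[-C,C)$, $j=1,\dots,M$, can be uniquely reconstructed (i.e., the set of pairs $(\lambda_j,c_j)$, $j=1,\dots,M$, is uniquely determined among all functions of this form) from the function samples $f(G^{-1}(\tau k+G(x_0)))$, $k=0,\dots,2M-1$.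
   Context: $G^{-1}:G(I)\to I$ is the inverse of the strictly monotone function $G$. The functions $G$, $H$ and the numbers $M$, $C$, $\tau$, $x_0$ are known; the $c_j$ and $\lambda_j$ are the parameters to be reconstructed. *)

theory Defs
  imports "HOL-Analysis.Analysis"
begin

(* Derivatives are taken relative to S, i.e. one-sided at an endpoint of an interval that
   belongs to it. D n is the n-th derivative of f on S. *)
definition smooth_on :: "real set \<Rightarrow> (real \<Rightarrow> 'a::real_normed_vector) \<Rightarrow> bool" where
  "smooth_on S f \<longleftrightarrow>
     (\<exists>D :: nat \<Rightarrow> real \<Rightarrow> 'a.
        (\<forall>x\<in>S. D 0 x = f x) \<and>
        (\<forall>n. \<forall>x\<in>S. (D n has_vector_derivative D (Suc n) x) (at x within S)))"

definition gen_exp_sum ::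
  "(real \<Rightarrow> real) \<Rightarrow> (real \<Rightarrow> complex) \<Rightarrow> nat \<Rightarrow> (nat \<Rightarrow> complex) \<Rightarrow> (nat \<Rightarrow> complex) \<Rightarrow> real \<Rightarrow> complex"
  where
  "gen_exp_sum G H M c lam x =
     (\<Sum>j=1..M. c j * exp (H x + lam j * complex_of_real (G x)))"

definition admissible_params ::
  "nat \<Rightarrow> real \<Rightarrow> (nat \<Rightarrow> complex) \<Rightarrow> (nat \<Rightarrow> complex) \<Rightarrow> bool" where
  "admissible_params M C c lam \<longleftrightarrow>
     (\<forall>j\<in>{1..M}. c j \<noteq> 0) \<and>
     inj_on lam {1..M} \<and>
     (\<forall>j\<in>{1..M}. Im (lam j) \<in> {-C..<C})"

definition param_pairs ::
  "nat \<Rightarrow> (nat \<Rightarrow> complex) \<Rightarrow> (nat \<Rightarrow> complex) \<Rightarrow> (complex \<times> complex) set" where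
  "param_pairs M c lam = (\<lambda>j. (lam j, c j)) ` {1..M}"

end

theory Submission
  imports Defs
begin

text \<open>At the point of I where G takes the value \<open>\<tau> k + G x0\<close>, the function
  divided by \<open>exp (H x)\<close> is \<open>\<Sum>j. a j * z j ^ k\<close> with \<open>z j = exp (\<tau> * lam j)\<close> and
  \<open>a j = c j * exp (lam j * G x0)\<close>. So \<open>2 M\<close> samples are \<open>2 M\<close> consecutive power sums.
  If two parameter sets have the same samples, the difference of their power sums is a power sum
  over the union of the two frequency sets, which has at most \<open>2 M\<close> elements. Power sums with at
  most as many distinct nodes as equations vanish only if all weights do
  (\<open>power_sums_zero_imp_weights_zero\<close>, invertibility of the Vandermonde matrix), so each
  frequency has the same total coefficient in both functions. These totals determine the
  parameter pairs, because no coefficient is zero and the frequencies are distinct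
  (\<open>param_pairs_eq_coeff_at\<close>).

  Two facts make this work. The strip \<open>-C \<le> Im l < C\<close> has width \<open>2 C\<close>, and
  \<open>\<bar>\<tau>\<bar> * 2 C \<le> 2 pi\<close>, so distinct frequencies give distinct nodes
  (\<open>exp_scaled_inj_on_strip\<close>). And G is injective by Rolle's theorem
  (\<open>smooth_nonzero_derivative_inj_on\<close>), so the sample points are well defined.\<close>

text \<open>By linearity the hypothesis says that every polynomial of degree below N has weighted sum
  zero over the nodes. The polynomial that vanishes at all nodes but one then isolates the weight
  at that node.\<close>

lemma power_sums_zero_imp_weights_zero:
  fixes a z :: "'b \<Rightarrow> 'a::field"
  assumes fin: "finite A" and card: "card A \<le> N" and inj: "inj_on z A"
    and zero: "\<And>k. k < N \<Longrightarrow> (\<Sum>l\<in>A. a l * z l ^ k) = 0"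
    and m: "m \<in> A"
  shows "a m = 0"
proof -
  define p where "p = (\<Prod>l\<in>A - {m}. [:- z l, 1:])"
  have "degree p \<le> (\<Sum>l\<in>A - {m}. degree [:- z l, 1:])"
    unfolding p_def using fin by (intro degree_prod_sum_le[unfolded o_def]) simp
  also have "\<dots> = card A - 1"
    using fin m by simp
  also have "\<dots> < N"
    using card card_gt_0_iff[of A] fin m by (cases "card A") auto
  finally have deg: "degree p < N" .
  have "(\<Sum>l\<in>A. a l * poly p (z l)) = (\<Sum>l\<in>A. \<Sum>k\<le>degree p. coeff p k * (a l * z l ^ k))"
    by (simp add: poly_altdef sum_distrib_left mult_ac)
  also have "\<dots> = (\<Sum>k\<le>degree p. coeff p k * (\<Sum>l\<in>A. a l * z l ^ k))"
    by (subst sum.swap) (simp add: sum_distrib_left)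
  also have "\<dots> = 0"
    using deg zero by simp
  finally have "(\<Sum>l\<in>A. a l * poly p (z l)) = 0" .
  moreover have "poly p (z l) = 0" if "l \<in> A - {m}" for l
    unfolding p_def poly_prod using fin that by (intro prod_zero) auto
  ultimately have "a m * poly p (z m) = 0"
    using fin m by (simp add: sum.remove[of A m])
  moreover have "poly p (z m) \<noteq> 0"
    using fin inj m by (auto simp: p_def poly_prod inj_on_def)
  ultimately show ?thesis by simp
qed

lemma exp_scaled_inj_on_strip:
  assumes "C > 0" "\<tau> \<noteq> 0" "\<bar>\<tau>\<bar> \<le> pi / C"
  shows "inj_on (\<lambda>l. exp (of_real \<tau> * l)) {l. Im l \<in> {-C..<C}}"
proof (rule inj_onI)
  fix l m :: complex
  assume l: "l \<in> {l. Im l \<in> {-C..<C}}" and m: "m \<in> {l. Im l \<in> {-C..<C}}"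
    and eq: "exp (of_real \<tau> * l) = exp (of_real \<tau> * m)"
  \<comment> \<open>Strict because the strip is half-open; with equality the two exponentials could coincide.\<close>
  have "\<bar>Im l - Im m\<bar> < 2 * C"
    using l m by auto
  hence "\<bar>\<tau>\<bar> * \<bar>Im l - Im m\<bar> < \<bar>\<tau>\<bar> * (2 * C)"
    using assms by (intro mult_strict_left_mono) auto
  also have "\<dots> \<le> 2 * pi"
    using assms by (simp add: field_simps)
  finally have "\<bar>Im (of_real \<tau> * l) - Im (of_real \<tau> * m)\<bar> < 2 * pi"
    by (simp add: abs_mult flip: right_diff_distrib)
  from exp_complex_eqI[OF this eq] show "l = m"
    using assms by simp
qed

text \<open>If G took the same value twice, Rolle's theorem would give a zero of the derivative
  strictly between the two arguments. That point is interior to I, so there the one-sided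
  derivative relative to I is the ordinary one.\<close>

lemma smooth_nonzero_derivative_inj_on:
  fixes G :: "real \<Rightarrow> real"
  assumes I: "is_interval I" and sm: "smooth_on I G"
    and nz: "\<And>x. x \<in> I \<Longrightarrow> vector_derivative G (at x within I) \<noteq> 0"
  shows "inj_on G I"
proof (rule linorder_inj_onI')
  obtain D where D0: "\<And>x. x \<in> I \<Longrightarrow> D 0 x = G x"
    and D: "\<And>n x. x \<in> I \<Longrightarrow> (D n has_vector_derivative D (Suc n) x) (at x within I)"
    using sm unfolding smooth_on_def by blast
  have G': "(G has_vector_derivative D 1 x) (at x within I)" if "x \<in> I" for x
    using has_vector_derivative_transform[OF that _ D[OF that, of 0]] D0 by simp
  fix x y assume x: "x \<in> I" and y: "y \<in> I" and less: "x < y"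
  have sub: "{x..y} \<subseteq> I"
    using interval_subset_is_interval[OF I, of x y] x y by (simp add: box_real)
  have at_I: "at w within I = at w" if "w \<in> {x<..<y}" for w
  proof -
    have "w \<in> interior I"
      using interior_mono[OF sub] that by auto
    thus ?thesis by (rule at_within_interior)
  qed
  have deriv: "(G has_vector_derivative D 1 w) (at w)" if "w \<in> {x<..<y}" for w
  proof -
    have "w \<in> I"
      using sub that by auto
    from G'[OF this] show ?thesis
      unfolding at_I[OF that] .
  qed
  show "G x \<noteq> G y"
  proof
    assume eq: "G x = G y"
    have cont: "continuous_on I G"
      unfolding continuous_on_eq_continuous_within
      using G' has_vector_derivative_continuous by blast
    obtain w where w: "w \<in> {x<..<y}" and eq0: "(\<lambda>v. v * D 1 w) = (\<lambda>v. 0)"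
      using Rolle_deriv[OF less eq continuous_on_subset[OF cont sub], of "\<lambda>w v. v * D 1 w"] deriv
      by (auto simp: has_vector_derivative_def)
    have "D 1 w = 0"
      using fun_cong[OF eq0, of 1] by simp
    hence "vector_derivative G (at w within I) = 0"
      unfolding at_I[OF w] using vector_derivative_at[OF deriv[OF w]] by simp
    moreover have "w \<in> I"
      using sub w by auto
    ultimately show False
      using nz by blast
  qed
qed

text \<open>The total coefficient that a frequency carries; it is zero at a frequency that does not
  occur. It gives two sums over different frequency sets a common domain, on which they can be
  subtracted.\<close>

definition coeff_at :: "nat \<Rightarrow> (nat \<Rightarrow> complex) \<Rightarrow> (nat \<Rightarrow> complex) \<Rightarrow> complex \<Rightarrow> complex" where
  "coeff_at M c lam l = (\<Sum>j | j \<in> {1..M} \<and> lam j = l. c j)"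

lemma sum_eq_sum_coeff_at:
  assumes "finite A" "lam ` {1..M} \<subseteq> A"
  shows "(\<Sum>j=1..M. c j * F (lam j)) = (\<Sum>l\<in>A. coeff_at M c lam l * F l)"
proof -
  have "(\<Sum>l\<in>A. coeff_at M c lam l * F l)
      = (\<Sum>l\<in>A. \<Sum>j | j \<in> {1..M} \<and> lam j = l. c j * F (lam j))"
    by (simp add: coeff_at_def sum_distrib_right)
  also have "\<dots> = (\<Sum>j=1..M. c j * F (lam j))"
    using assms by (intro sum.group) auto
  finally show ?thesis by simp
qed

lemma coeff_at_outside: "l \<notin> lam ` {1..M} \<Longrightarrow> coeff_at M c lam l = 0"
  by (auto simp: coeff_at_def intro!: sum.neutral)

lemma coeff_at_lam:
  assumes "admissible_params M C c lam" "j \<in> {1..M}"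
  shows "coeff_at M c lam (lam j) = c j"
proof -
  have "inj_on lam {1..M}"
    using assms(1) by (simp add: admissible_params_def)
  hence "{i. i \<in> {1..M} \<and> lam i = lam j} = {j}"
    using assms(2) unfolding inj_on_def by blast
  thus ?thesis by (simp add: coeff_at_def)
qed

lemma param_pairs_eq_coeff_at:
  assumes adm: "admissible_params M C c lam"
  shows "param_pairs M c lam = {(l, w). w \<noteq> 0 \<and> w = coeff_at M c lam l}"
proof (intro set_eqI iffI)
  fix p assume "p \<in> param_pairs M c lam"
  then obtain j where "j \<in> {1..M}" "p = (lam j, c j)"
    by (auto simp: param_pairs_def)
  thus "p \<in> {(l, w). w \<noteq> 0 \<and> w = coeff_at M c lam l}"
    using adm coeff_at_lam[OF adm] by (auto simp: admissible_params_def)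
next
  fix p assume p: "p \<in> {(l, w). w \<noteq> 0 \<and> w = coeff_at M c lam l}"
  hence "fst p \<in> lam ` {1..M}"
    using coeff_at_outside[of "fst p" lam M c] by force
  then obtain j where "j \<in> {1..M}" "fst p = lam j"
    by blast
  thus "p \<in> param_pairs M c lam"
    using p coeff_at_lam[OF adm] by (cases p) (auto simp: param_pairs_def)
qed

lemma gen_exp_sum_sample:
  assumes G: "G x = \<tau> * real k + y"
  shows "gen_exp_sum G H M c lam x
       = exp (H x) * (\<Sum>j=1..M. c j * (exp (lam j * of_real y) * exp (of_real \<tau> * lam j) ^ k))"
proof -
  have "exp (H x + l * of_real (G x))
      = exp (H x) * (exp (l * of_real y) * exp (of_real \<tau> * l) ^ k)" for l :: complex
  proof -
    have "H x + l * of_real (G x) = H x + (l * of_real y + of_nat k * (of_real \<tau> * l))"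
      by (simp add: G algebra_simps)
    thus ?thesis
      by (simp only: exp_add exp_of_nat_mult)
  qed
  thus ?thesis
    by (simp add: gen_exp_sum_def sum_distrib_left mult_ac)
qed

theorem theorem4p1:
  fixes I J :: "real set"
    and G :: "real \<Rightarrow> real"
    and H :: "real \<Rightarrow> complex"
    and C \<tau> x0 :: real
    and M :: nat
    and c c' lam lam' :: "nat \<Rightarrow> complex"
  assumes "is_interval I"
    and "G ` I \<subseteq> J"
    and "smooth_on I G"
    and "\<And>x. x \<in> I \<Longrightarrow> \<bar>vector_derivative G (at x within I)\<bar> > 0"
    and "smooth_on I H"
    and "C > 0"
    and "x0 \<in> I"
    and "0 < \<bar>\<tau>\<bar>" and "\<bar>\<tau>\<bar> \<le> pi / C"
    and "\<And>k. k < 2 * M \<Longrightarrow> \<tau> * real k + G x0 \<in> G ` I"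
    and "admissible_params M C c lam"
    and "admissible_params M C c' lam'"
    and "\<And>k. k < 2 * M \<Longrightarrow>
           gen_exp_sum G H M c lam (the_inv_into I G (\<tau> * real k + G x0)) =
           gen_exp_sum G H M c' lam' (the_inv_into I G (\<tau> * real k + G x0))"
  shows "param_pairs M c lam = param_pairs M c' lam'"
proof -
  have inj: "inj_on G I"
    using assms(4) by (intro smooth_nonzero_derivative_inj_on assms) force
  define A where "A = lam ` {1..M} \<union> lam' ` {1..M}"
  define F where "F l = exp (l * of_real (G x0))" for l :: complex
  define z where "z l = exp (of_real \<tau> * l)" for l :: complex
  define a where "a l = (coeff_at M c lam l - coeff_at M c' lam' l) * F l" for l
  have fin: "finite A"
    by (simp add: A_def)
  have card: "card A \<le> 2 * M"
    using card_Un_le[of "lam ` {1..M}" "lam' ` {1..M}"]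
      card_image_le[of "{1..M}" lam] card_image_le[of "{1..M}" lam']
    by (simp add: A_def)
  have "A \<subseteq> {l. Im l \<in> {-C..<C}}"
    using assms(11,12) by (auto simp: A_def admissible_params_def)
  hence inj_z: "inj_on z A"
    using exp_scaled_inj_on_strip[of C \<tau>] assms(6,8,9)
    unfolding z_def by (auto intro: inj_on_subset)
  have zero: "(\<Sum>l\<in>A. a l * z l ^ k) = 0" if k: "k < 2 * M" for k
  proof -
    define x where "x = the_inv_into I G (\<tau> * real k + G x0)"
    have Gx: "G x = \<tau> * real k + G x0"
      unfolding x_def by (rule f_the_inv_into_f[OF inj assms(10)[OF k]])
    have "(\<Sum>j=1..M. c j * (F (lam j) * z (lam j) ^ k))
        = (\<Sum>j=1..M. c' j * (F (lam' j) * z (lam' j) ^ k))"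
      using assms(13)[OF k, folded x_def] unfolding gen_exp_sum_sample[of G, OF Gx] F_def z_def
      by simp
    moreover have "(\<Sum>j=1..M. c j * (F (lam j) * z (lam j) ^ k))
        = (\<Sum>l\<in>A. coeff_at M c lam l * (F l * z l ^ k))"
      by (rule sum_eq_sum_coeff_at[OF fin, where F = "\<lambda>l. F l * z l ^ k"]) (simp add: A_def)
    moreover have "(\<Sum>j=1..M. c' j * (F (lam' j) * z (lam' j) ^ k))
        = (\<Sum>l\<in>A. coeff_at M c' lam' l * (F l * z l ^ k))"
      by (rule sum_eq_sum_coeff_at[OF fin, where F = "\<lambda>l. F l * z l ^ k"]) (simp add: A_def)
    ultimately show ?thesis
      by (simp add: a_def algebra_simps sum_subtractf)
  qed
  have "coeff_at M c lam l = coeff_at M c' lam' l" for l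
  proof (cases "l \<in> A")
    case True
    have "a l = 0"
      by (rule power_sums_zero_imp_weights_zero[OF fin card inj_z zero True])
    thus ?thesis by (simp add: a_def F_def)
  next
    case False
    thus ?thesis by (simp add: A_def coeff_at_outside)
  qed
  thus ?thesis
    by (simp add: param_pairs_eq_coeff_at[OF assms(11)] param_pairs_eq_coeff_at[OF assms(12)])
qed

end
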